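(* Let $\delta,\rho\in(0,1)$. Let $\mathcal D$ be a distribution over $\mathcal X\times\{0,1\}$ and $S=\{(x_i,y_i)\}_{i\in[n]}$ be a sample of size $n$ drawn i.i.d. from $\mathcal D$. Let $A$ be an $n$-sample $\rho$-TV indistinguishable learning rule. Then, with probability at least $1-\delta-4\sqrt\rho$ over $S$, it holds that $$\left|\mathbf E_{h\sim A(S)}[L(h)]-\mathbf E_{h\sim A(S)}[\widehat L(h)]\right|\le\sqrt{\frac{\log(2/\delta)}{2n}}+\sqrt\rho,$$ where $L(h)=\Pr_{(x,y)\sim\mathcal D}[h(x)\ne y]$ and $\widehat L(h)=\frac1n\sum_{(x,y)\in S}\mathbf 1\{h(x)\ne y\}$.
   Context: An $n$-sample learning rule over a domain $\mathcal X$ is a randomized map $A:(\mathcal X\times\{0,1\})^n\to\{0,1\}^{\mathcal X}$; $A(S)$ denotes the probability distribution of its output on input $S$. $A$ is $n$-sample $\rho$-TV indistinguishable if for every distribution $\mathcal D$ over $\mathcal X\times\{0,1\}$ and independent $S,S'\sim\mathcal D^n$, $\mathbf E_{S,S'}[d_{\mathrm{TV}}(A(S),A(S'))]\le\rho$, where $d_{\mathrm{TV}}$ is total variation distance. $\log$ is the natural logarithm. *)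

theory Defs
  imports "HOL-Probability.Probability"
begin

text \<open>
  The domain is the measurable space \<open>X\<close>; the labels 0 and 1 are \<open>False\<close> and \<open>True\<close>.
\<close>

definition labelled :: "'a measure \<Rightarrow> ('a \<times> bool) measure" where
  "labelled X = X \<Otimes>\<^sub>M count_space UNIV"

definition distribution_over :: "'b measure \<Rightarrow> 'b measure \<Rightarrow> bool" where
  "distribution_over M D \<longleftrightarrow> prob_space D \<and> sets D = sets M"

text \<open>
  A measurable space of hypotheses: its points are maps from the domain to the labels, and
  the evaluation map \<open>(h, x) \<mapsto> h x\<close> is jointly measurable, so that the losses below are
  measurable. The set of all maps on an uncountable domain carries no such sigma-algebra in
  general, hence the inclusion instead of an equality.
\<close>

definition hypothesis_space :: "'a measure \<Rightarrow> ('a \<Rightarrow> bool) measure \<Rightarrow> bool" where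
  "hypothesis_space X H \<longleftrightarrow>
     space H \<subseteq> (space X \<rightarrow>\<^sub>E UNIV) \<and>
     (\<lambda>(h, x). h x) \<in> H \<Otimes>\<^sub>M X \<rightarrow>\<^sub>M count_space UNIV"

text \<open>
  Over a countable discrete domain, the set of all maps with the product sigma-algebra is a
  hypothesis space.
\<close>

lemma hypothesis_space_countable:
  fixes I :: "'a set"
  assumes "countable I"
  shows "hypothesis_space (count_space I) (\<Pi>\<^sub>M i\<in>I. count_space (UNIV :: bool set))"
proof -
  let ?H = "\<Pi>\<^sub>M i\<in>I. count_space (UNIV :: bool set)"
  have "(\<lambda>p. (\<lambda>i p. fst p i) (snd p) p) \<in> ?H \<Otimes>\<^sub>M count_space I \<rightarrow>\<^sub>M count_space (UNIV :: bool set)"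
    by (rule measurable_compose_countable'[OF _ _ assms])
       (auto intro!: measurable_compose[OF measurable_fst measurable_component_singleton])
  then show ?thesis
    by (auto simp: hypothesis_space_def space_PiM case_prod_beta)
qed

text \<open>The i.i.d. sample of size \<open>n\<close>, as a random family indexed by \<open>{..<n}\<close>.\<close>

definition iid :: "nat \<Rightarrow> 'b measure \<Rightarrow> (nat \<Rightarrow> 'b) measure" where
  "iid n D = (\<Pi>\<^sub>M i\<in>{..<n}. D)"

text \<open>
  A randomized map is given by its output distributions \<open>A S\<close>, i.e. it is a Markov kernel
  from samples to hypotheses.
\<close>

definition learning_rule ::
  "nat \<Rightarrow> 'a measure \<Rightarrow> ('a \<Rightarrow> bool) measure \<Rightarrow>
   ((nat \<Rightarrow> 'a \<times> bool) \<Rightarrow> ('a \<Rightarrow> bool) measure) \<Rightarrow> bool" where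
  "learning_rule n X H A \<longleftrightarrow>
     hypothesis_space X H \<and>
     A \<in> (\<Pi>\<^sub>M i\<in>{..<n}. labelled X) \<rightarrow>\<^sub>M prob_algebra H"

text \<open>For probability measures \<open>P\<close> and \<open>Q\<close> on the same sigma-algebra.\<close>

definition tv_dist :: "'b measure \<Rightarrow> 'b measure \<Rightarrow> real" where
  "tv_dist P Q = (SUP E\<in>sets P. \<bar>measure P E - measure Q E\<bar>)"

text \<open>
  The total variation distance need not be measurable in the samples when \<open>H\<close> is not
  countably generated. The nonnegative integral then is the lower integral, which makes the
  condition weaker; the Bochner integral would be 0 for a non-measurable integrand.
\<close>

definition tv_indistinguishable ::
  "nat \<Rightarrow> real \<Rightarrow> 'a measure \<Rightarrow>
   ((nat \<Rightarrow> 'a \<times> bool) \<Rightarrow> ('a \<Rightarrow> bool) measure) \<Rightarrow> bool" where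
  "tv_indistinguishable n \<rho> X A \<longleftrightarrow>
     (\<forall>D. distribution_over (labelled X) D \<longrightarrow>
        (\<integral>\<^sup>+ (S, S'). ennreal (tv_dist (A S) (A S')) \<partial>(iid n D \<Otimes>\<^sub>M iid n D)) \<le> ennreal \<rho>)"

definition loss :: "('a \<times> bool) measure \<Rightarrow> ('a \<Rightarrow> bool) \<Rightarrow> real" where
  "loss D h = measure D {z \<in> space D. h (fst z) \<noteq> snd z}"

definition empirical_loss :: "nat \<Rightarrow> (nat \<Rightarrow> 'a \<times> bool) \<Rightarrow> ('a \<Rightarrow> bool) \<Rightarrow> real" where
  "empirical_loss n S h = (1 / real n) * (\<Sum>i<n. of_bool (h (fst (S i)) \<noteq> snd (S i)))"

end

theory Submission
  imports Defs
begin

text \<open>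
  For a second sample \<open>T\<close> independent of \<open>S\<close>, the output distribution \<open>A T\<close> does not depend on
  \<open>S\<close>, so Hoeffding's inequality bounds the generalization gap of \<open>A T\<close> on \<open>S\<close>. Replacing
  \<open>A T\<close> by \<open>A S\<close> changes both expected losses by at most \<open>tv_dist (A S) (A T)\<close>: each of them
  is an average over \<open>z\<close> of the probability of mislabelling \<open>z\<close>. Markov's inequality
  bounds the probability that the total change exceeds \<open>sqrt \<rho>\<close> by \<open>2 * sqrt \<rho>\<close>.
\<close>

text \<open>A real supremum dominates its members only if the family is bounded above; probabilities
  differ by at most 1, which supplies the bound.\<close>

lemma abs_measure_diff_le_tv_dist:
  assumes "prob_space P" "prob_space Q" "E \<in> sets P"
  shows "\<bar>measure P E - measure Q E\<bar> \<le> tv_dist P Q"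
  unfolding tv_dist_def
proof (rule cSUP_upper[OF assms(3)], rule bdd_aboveI2)
  fix B
  have "0 \<le> measure P B" "measure P B \<le> 1" "0 \<le> measure Q B" "measure Q B \<le> 1"
    using assms by (auto simp: prob_space.prob_le_1)
  then show "\<bar>measure P B - measure Q B\<bar> \<le> 1" by linarith
qed

text \<open>Here the example is fixed and the hypothesis is random. Both expected losses are
  averages of this one function of the example, over \<open>D\<close> and over the sample
  points.\<close>

definition error_prob :: "('a \<Rightarrow> bool) measure \<Rightarrow> 'a \<times> bool \<Rightarrow> real" where
  "error_prob P z = measure P {h \<in> space P. h (fst z) \<noteq> snd z}"

lemma error_prob_bounds:
  assumes "prob_space P"
  shows "0 \<le> error_prob P z" "error_prob P z \<le> 1"
  using assms by (auto simp: error_prob_def prob_space.prob_le_1)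

text \<open>This is where joint measurability of the evaluation map enters. The measurability of
  errors below is obtained from this set, its sections and its preimages.\<close>

lemma sets_mislabelled_pairs:
  assumes "hypothesis_space X H"
  shows "{w \<in> space (H \<Otimes>\<^sub>M labelled X). fst w (fst (snd w)) \<noteq> snd (snd w)}
           \<in> sets (H \<Otimes>\<^sub>M labelled X)"
proof -
  have [measurable]: "(\<lambda>(h, x). h x) \<in> H \<Otimes>\<^sub>M X \<rightarrow>\<^sub>M count_space UNIV"
    using assms by (simp add: hypothesis_space_def)
  have "(\<lambda>w. (case (fst w, fst (snd w)) of (h, x) \<Rightarrow> h x))
      \<in> H \<Otimes>\<^sub>M labelled X \<rightarrow>\<^sub>M count_space UNIV"
    unfolding labelled_def by measurable
  then have [measurable]: "(\<lambda>w. fst w (fst (snd w))) \<in> H \<Otimes>\<^sub>M labelled X \<rightarrow>\<^sub>M count_space UNIV"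
    by simp
  have [measurable]: "(\<lambda>w. snd (snd w)) \<in> H \<Otimes>\<^sub>M labelled X \<rightarrow>\<^sub>M count_space UNIV"
    unfolding labelled_def by measurable
  show ?thesis by measurable
qed

text \<open>The set is the section at \<open>z\<close> of the set of mislabelled pairs.\<close>

lemma sets_mislabelling:
  assumes "hypothesis_space X H" "z \<in> space (labelled X)"
  shows "{h \<in> space H. h (fst z) \<noteq> snd z} \<in> sets H"
proof -
  have "(\<lambda>h. (h, z)) \<in> H \<rightarrow>\<^sub>M H \<Otimes>\<^sub>M labelled X"
    using assms(2) by measurable
  from measurable_sets[OF this sets_mislabelled_pairs[OF assms(1)]]
  show ?thesis
    by (rule back_subst[where P = "\<lambda>B. B \<in> sets H"])
       (use assms(2) in \<open>auto simp: space_pair_measure\<close>)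
qed

text \<open>Joint measurability in \<open>s\<close> and \<open>z\<close> allows the training sample
  and the example to vary independently, as they do when the output of one sample is tested on
  another.\<close>

lemma measurable_error_prob_kernel:
  assumes H: "hypothesis_space X H" and A: "A \<in> N \<rightarrow>\<^sub>M prob_algebra H"
  shows "(\<lambda>(s, z). error_prob (A s) z) \<in> borel_measurable (N \<Otimes>\<^sub>M labelled X)"
proof -
  have A': "(\<lambda>w. A (fst w)) \<in> N \<Otimes>\<^sub>M labelled X \<rightarrow>\<^sub>M prob_algebra H"
    using A by measurable
  have "(\<lambda>w. (snd w, snd (fst w)))
          \<in> (N \<Otimes>\<^sub>M labelled X) \<Otimes>\<^sub>M H \<rightarrow>\<^sub>M H \<Otimes>\<^sub>M labelled X"
    by measurable
  from measurable_sets[OF this sets_mislabelled_pairs[OF H]]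
  \<comment> \<open>The fibre of this set over \<open>w = (s, z)\<close> is the event of
    mislabelling \<open>z\<close>, and a kernel assigns to the fibres of a measurable set a
    measurable function.\<close>
  have "(SIGMA w:space (N \<Otimes>\<^sub>M labelled X). {h \<in> space H. h (fst (snd w)) \<noteq> snd (snd w)})
          \<in> sets ((N \<Otimes>\<^sub>M labelled X) \<Otimes>\<^sub>M H)"
    by (rule back_subst[where P = "\<lambda>B. B \<in> sets ((N \<Otimes>\<^sub>M labelled X) \<Otimes>\<^sub>M H)"])
       (auto simp: space_pair_measure)
  from measure_measurable_prob_algebra2[OF this A']
  show ?thesis
  proof (rule measurable_cong[THEN iffD1, rotated])
    fix w assume w: "w \<in> space (N \<Otimes>\<^sub>M labelled X)"
    then have "A (fst w) \<in> space (prob_algebra H)"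
      by (intro measurable_space[OF A]) (auto simp: space_pair_measure)
    then have "space (A (fst w)) = space H"
      by (auto simp: space_prob_algebra dest: sets_eq_imp_space_eq)
    then show "measure (A (fst w)) {h \<in> space H. h (fst (snd w)) \<noteq> snd (snd w)}
        = (case w of (s, z) \<Rightarrow> error_prob (A s) z)"
      by (simp add: error_prob_def case_prod_beta)
  qed
qed

text \<open>Fubini for the indicator of the mislabelled pairs under the product of \<open>P\<close>
  and \<open>D\<close>.\<close>

lemma integral_loss_eq:
  assumes H: "hypothesis_space X H" and D: "prob_space D" "sets D = sets (labelled X)"
    and P: "prob_space P" "sets P = sets H"
  shows "(\<integral>h. loss D h \<partial>P) = (\<integral>z. error_prob P z \<partial>D)"
proof -
  interpret D: prob_space D by fact
  interpret P: prob_space P by fact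
  interpret PD: pair_prob_space P D ..
  note sp = sets_eq_imp_space_eq[OF D(2)] sets_eq_imp_space_eq[OF P(2)]
  let ?B = "{w \<in> space (P \<Otimes>\<^sub>M D). fst w (fst (snd w)) \<noteq> snd (snd w)}"
  have B: "?B \<in> sets (P \<Otimes>\<^sub>M D)"
    using sets_mislabelled_pairs[OF H]
    by (simp add: sets_pair_measure_cong[OF P(2) D(2)] space_pair_measure sp)
  let ?f = "\<lambda>h z. indicator ?B (h, z) :: real"
  have int: "integrable (P \<Otimes>\<^sub>M D) (case_prod ?f)"
    using B by (simp add: less_top[symmetric] PD.P.emeasure_eq_measure)
  have "(\<integral>h. loss D h \<partial>P) = (\<integral>h. (\<integral>z. ?f h z \<partial>D) \<partial>P)"
  proof (rule Bochner_Integration.integral_cong[OF refl])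
    fix h assume h: "h \<in> space P"
    have "(\<integral>z. ?f h z \<partial>D) = (\<integral>z. indicator {z \<in> space D. h (fst z) \<noteq> snd z} z \<partial>D)"
      by (intro Bochner_Integration.integral_cong refl)
         (auto simp: indicator_def space_pair_measure h)
    then show "loss D h = (\<integral>z. ?f h z \<partial>D)"
      by (simp add: loss_def Int_absorb2)
  qed
  also have "\<dots> = (\<integral>z. (\<integral>h. ?f h z \<partial>P) \<partial>D)"
    by (rule PD.Fubini_integral[OF int, symmetric])
  also have "\<dots> = (\<integral>z. error_prob P z \<partial>D)"
  proof (rule Bochner_Integration.integral_cong[OF refl])
    fix z assume z: "z \<in> space D"
    have "(\<integral>h. ?f h z \<partial>P) = (\<integral>h. indicator {h \<in> space P. h (fst z) \<noteq> snd z} h \<partial>P)"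
      by (intro Bochner_Integration.integral_cong refl)
         (auto simp: indicator_def space_pair_measure z)
    then show "(\<integral>h. ?f h z \<partial>P) = error_prob P z"
      by (simp add: error_prob_def Int_absorb2)
  qed
  finally show ?thesis .
qed

text \<open>The counterpart of \<open>integral_loss_eq\<close> for the empirical average, where
  linearity of the integral takes the place of Fubini.\<close>

lemma integral_empirical_loss_eq:
  assumes H: "hypothesis_space X H" and P: "prob_space P" "sets P = sets H"
    and S: "\<And>i. i < n \<Longrightarrow> S i \<in> space (labelled X)"
  shows "(\<integral>h. empirical_loss n S h \<partial>P) = (\<Sum>i<n. error_prob P (S i)) / real n"
proof -
  interpret prob_space P by fact
  have "(\<integral>h. empirical_loss n S h \<partial>P)
      = (\<integral>h. (1 / real n) * (\<Sum>i<n. indicator {h \<in> space P. h (fst (S i)) \<noteq> snd (S i)} h) \<partial>P)"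
    by (intro Bochner_Integration.integral_cong refl)
       (auto simp: empirical_loss_def indicator_def intro!: sum.cong)
  also have "\<dots> = (1 / real n) * (\<Sum>i<n. error_prob P (S i))"
  proof -
    have "{h \<in> space P. h (fst (S i)) \<noteq> snd (S i)} \<in> sets P" if "i < n" for i
      using sets_mislabelling[OF H S[OF that]] P(2) sets_eq_imp_space_eq[OF P(2)] by simp
    then show ?thesis
      by (subst integral_mult_right_zero, subst Bochner_Integration.integral_sum)
         (auto simp: error_prob_def Int_absorb2 intro!: integrable_real_indicator simp: less_top[symmetric])
  qed
  finally show ?thesis by simp
qed

text \<open>Independence means that the joint law is the product of the marginals. The joint law of
  the coordinates is \<open>PiM I M\<close> itself, because restricting to \<open>I\<close> fixes
  every point of its space.\<close>

lemma indep_vars_PiM_coordinates: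
  assumes "\<And>i. i \<in> I \<Longrightarrow> prob_space (M i)" "I \<noteq> {}"
  shows "prob_space.indep_vars (PiM I M) M (\<lambda>i \<omega>. \<omega> i) I"
proof -
  interpret prob_space "PiM I M" by (rule prob_space_PiM) (rule assms)
  have "distr (PiM I M) (PiM I M) (\<lambda>\<omega>. \<lambda>i\<in>I. \<omega> i) = distr (PiM I M) (PiM I M) (\<lambda>\<omega>. \<omega>)"
    by (rule distr_cong) (auto simp: space_PiM PiE_def extensional_restrict)
  also have "\<dots> = PiM I M" by simp
  also have "\<dots> = (\<Pi>\<^sub>M i\<in>I. distr (PiM I M) (M i) (\<lambda>\<omega>. \<omega> i))"
    by (rule PiM_cong) (simp_all add: distr_PiM_component assms)
  finally show ?thesis
    by (subst indep_vars_iff_distr_eq_PiM'[OF assms(2)]) auto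
qed

text \<open>Two-sided Hoeffding for the variables \<open>g (S i)\<close>, which inherit independence
  and a common law from the coordinates. The function \<open>g\<close> must not depend on the
  sample.\<close>

lemma iid_Hoeffding:
  fixes g :: "'b \<Rightarrow> real"
  assumes "prob_space D" and g [measurable]: "g \<in> borel_measurable D"
    and bounds: "\<And>z. 0 \<le> g z" "\<And>z. g z \<le> 1" and "n \<ge> 1" "\<epsilon> \<ge> 0"
  shows "measure (iid n D)
           {S \<in> space (iid n D). \<bar>(\<integral>z. g z \<partial>D) - (\<Sum>i<n. g (S i)) / real n\<bar> \<ge> \<epsilon>}
         \<le> 2 * exp (- 2 * real n * \<epsilon>\<^sup>2)"
proof -
  interpret D: prob_space D by fact
  let ?P = "iid n D"
  interpret prob_space ?P
    unfolding iid_def by (intro prob_space_PiM assms)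
  have comp: "distr ?P D (\<lambda>S. S i) = D" if "i < n" for i
    unfolding iid_def using that by (intro distr_PiM_component) (auto intro: assms)
  have mcomp [measurable]: "(\<lambda>S. S i) \<in> ?P \<rightarrow>\<^sub>M D" if "i < n" for i
    unfolding iid_def using that by simp
  have n0: "0 < n" using assms by simp
  have distr: "distr ?P borel (\<lambda>S. g (S i)) = distr D borel g" if "i < n" for i
    using distr_distr[OF g mcomp[OF that]] comp[OF that] by (simp add: comp_def)
  have ind: "indep_vars (\<lambda>_. D) (\<lambda>i S. S i) {..<n}"
    unfolding iid_def by (rule indep_vars_PiM_coordinates) (use n0 assms in \<open>auto simp: lessThan_empty_iff\<close>)
  \<comment> \<open>Coordinate 0 exists since \<open>n\<close> is positive and represents the common
    law; 0 and 1 are the bounds on the range.\<close>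
  interpret Hoeffding_ineq_iid ?P "{..<n}" "\<lambda>i S. g (S i)" "\<lambda>S. g (S 0)" 0 1
    "expectation (\<lambda>S. g (S 0))"
  proof unfold_locales
    show "indep_vars (\<lambda>_. borel) (\<lambda>i S. g (S i)) {..<n}"
      using indep_vars_compose2[OF ind, of "\<lambda>_. g" "\<lambda>_. borel"] by simp
  qed (use n0 bounds in \<open>auto simp: distr\<close>)
  have "expectation (\<lambda>S. g (S 0)) = (\<integral>z. g z \<partial>D)"
    using integral_distr[OF mcomp[OF n0] g] comp[OF n0] by simp
  then show ?thesis
    using Hoeffding_ineq_abs_ge'[OF \<open>\<epsilon> \<ge> 0\<close>] n0
    by (simp add: abs_minus_commute lessThan_empty_iff del: expectation_X)
qed

theorem proposition1:
  fixes X :: "'a measure" and H :: "('a \<Rightarrow> bool) measure"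
    and D :: "('a \<times> bool) measure"
    and A :: "(nat \<Rightarrow> 'a \<times> bool) \<Rightarrow> ('a \<Rightarrow> bool) measure"
    and n :: nat and \<delta> \<rho> :: real
  assumes "0 < \<delta>" and "\<delta> < 1" and "0 < \<rho>" and "\<rho> < 1" and "n \<ge> 1"
    and "distribution_over (labelled X) D"
    and "learning_rule n X H A"
    and "tv_indistinguishable n \<rho> X A"
  shows "measure (iid n D)
           {S \<in> space (iid n D).
              \<bar>(\<integral>h. loss D h \<partial>A S) - (\<integral>h. empirical_loss n S h \<partial>A S)\<bar>
                \<le> sqrt (ln (2 / \<delta>) / (2 * real n)) + sqrt \<rho>}
         \<ge> 1 - \<delta> - 4 * sqrt \<rho>"
proof -
  have D: "prob_space D" "sets D = sets (labelled X)"
    using assms(6) by (auto simp: distribution_over_def)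
  interpret D: prob_space D by fact
  define P where "P = iid n D"
  interpret P: prob_space P
    unfolding P_def iid_def by (intro prob_space_PiM D)
  interpret Q: pair_prob_space P P ..
  let ?Q = "P \<Otimes>\<^sub>M P"
  have H: "hypothesis_space X H" and A: "A \<in> (\<Pi>\<^sub>M i\<in>{..<n}. labelled X) \<rightarrow>\<^sub>M prob_algebra H"
    using assms(7) by (auto simp: learning_rule_def)
  have setsP: "sets P = sets (\<Pi>\<^sub>M i\<in>{..<n}. labelled X)"
    unfolding P_def iid_def by (rule sets_PiM_cong) (simp_all add: D)
  have AP: "A \<in> P \<rightarrow>\<^sub>M prob_algebra H"
    using A setsP by (simp cong: measurable_cong_sets)
  have AS: "prob_space (A S)" "sets (A S) = sets H" if "S \<in> space P" for S
    using measurable_space[OF AP that] by (auto simp: space_prob_algebra)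
  have comp [measurable]: "(\<lambda>S. S i) \<in> P \<rightarrow>\<^sub>M D" if "i < n" for i
    unfolding P_def iid_def using that by simp
  have Si: "S i \<in> space D" if "S \<in> space P" "i < n" for S i
    using measurable_space[OF comp] that by blast
  have spD: "space D = space (labelled X)"
    by (rule sets_eq_imp_space_eq) (fact D)

  have p [measurable]: "(\<lambda>(S, z). error_prob (A S) z) \<in> borel_measurable (P \<Otimes>\<^sub>M D)"
    using measurable_error_prob_kernel[OF H AP]
    by (simp cong: measurable_cong_sets add: sets_pair_measure_cong[OF refl D(2)])
  \<comment> \<open>\<open>F S T\<close> is the generalization gap, measured on \<open>S\<close>, of
    the output distribution for \<open>T\<close>. The diagonal \<open>F S S\<close> is the quantity
    to be bounded; off the diagonal the two roles are independent.\<close>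
  define F where
    "F S T = (\<integral>z. error_prob (A T) z \<partial>D) - (\<Sum>i<n. error_prob (A T) (S i)) / real n" for S T
  have F [measurable]: "(\<lambda>(S, T). F S T) \<in> borel_measurable ?Q"
  proof -
    have [measurable]: "(\<lambda>w. error_prob (A (snd w)) (fst w i)) \<in> borel_measurable ?Q"
      if "i \<in> {..<n}" for i
    proof -
      have "i < n" using that by simp
      \<comment> \<open>The order is swapped: the second sample selects the output distribution, the
        first supplies the test example.\<close>
      then have "(\<lambda>w. (snd w, fst w i)) \<in> ?Q \<rightarrow>\<^sub>M P \<Otimes>\<^sub>M D" by measurable
      from measurable_compose[OF this p] show ?thesis by simp
    qed
    show ?thesis unfolding F_def case_prod_beta by measurable
  qed
  have [measurable]: "(\<lambda>S. F S S) \<in> borel_measurable P"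
    using measurable_compose[OF _ F, of "\<lambda>S. (S, S)" P] by simp
  have [measurable]: "(\<lambda>w. F (fst w) (fst w)) \<in> borel_measurable ?Q"
    by measurable
  have [measurable]: "(\<lambda>w. F (fst w) (snd w)) \<in> borel_measurable ?Q"
    using F by (simp add: case_prod_beta)
  have gap: "(\<integral>h. loss D h \<partial>A S) - (\<integral>h. empirical_loss n S h \<partial>A S) = F S S"
    if "S \<in> space P" for S
    using integral_loss_eq[OF H D AS[OF that]] integral_empirical_loss_eq[OF H AS[OF that], of n S]
      Si[OF that] by (simp add: F_def spD)

  \<comment> \<open>This value makes the two-sided Hoeffding bound equal to \<delta>.\<close>
  define \<epsilon> where "\<epsilon> = sqrt (ln (2 / \<delta>) / (2 * real n))"
  have ln0: "ln (2 / \<delta>) \<ge> 0" using assms(1,2) by simp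
  have eps: "\<epsilon> \<ge> 0" using ln0 by (simp add: \<epsilon>_def)
  have "- 2 * real n * \<epsilon>\<^sup>2 = - ln (2 / \<delta>)"
    using ln0 assms(5) by (simp add: \<epsilon>_def field_simps)
  then have exp_eps: "2 * exp (- 2 * real n * \<epsilon>\<^sup>2) = \<delta>"
    using assms(1) by (simp add: exp_minus)

  \<comment> \<open>The two ways to fail: the gap on an independent sample is large, or passing from
    \<open>A T\<close> to \<open>A S\<close> moves the gap too far.\<close>
  define E1 where "E1 = {w \<in> space ?Q. \<bar>F (fst w) (snd w)\<bar> \<ge> \<epsilon>}"
  define E2 where "E2 = {w \<in> space ?Q. \<bar>F (fst w) (fst w) - F (fst w) (snd w)\<bar> \<ge> sqrt \<rho>}"
  have [measurable]: "E1 \<in> sets ?Q" "E2 \<in> sets ?Q"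
    unfolding E1_def E2_def by measurable

  \<comment> \<open>Slicing at fixed \<open>T\<close> makes \<open>error_prob (A T)\<close> a fixed
    function, so Hoeffding applies to each slice with the same bound.\<close>
  have "emeasure ?Q E1 = (\<integral>\<^sup>+T. emeasure P ((\<lambda>S. (S, T)) -` E1) \<partial>P)"
    by (rule Q.emeasure_pair_measure_alt2) measurable
  also have "\<dots> \<le> (\<integral>\<^sup>+T. ennreal \<delta> \<partial>P)"
  proof (rule nn_integral_mono)
    fix T assume T: "T \<in> space P"
    have "(\<lambda>z. error_prob (A T) z) \<in> borel_measurable D"
      using measurable_compose[OF measurable_Pair1'[OF T] p] by simp
    from iid_Hoeffding[OF D(1) this error_prob_bounds[OF AS(1)[OF T]] \<open>n \<ge> 1\<close> eps]
    have "measure P {S \<in> space P. \<bar>F S T\<bar> \<ge> \<epsilon>} \<le> \<delta>"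
      using exp_eps by (simp add: F_def P_def)
    moreover have "(\<lambda>S. (S, T)) -` E1 = {S \<in> space P. \<bar>F S T\<bar> \<ge> \<epsilon>}"
      using T by (auto simp: E1_def space_pair_measure)
    ultimately show "emeasure P ((\<lambda>S. (S, T)) -` E1) \<le> ennreal \<delta>"
      by (simp add: P.emeasure_eq_measure ennreal_leI)
  qed
  also have "\<dots> = ennreal \<delta>" by (simp add: P.emeasure_space_1)
  finally have E1: "measure ?Q E1 \<le> \<delta>"
    using assms(1) by (simp add: Q.P.emeasure_eq_measure)

  \<comment> \<open>The factor 2 counts the two averages in \<open>F\<close>. Each moves by at most
    the distance, since \<open>error_prob\<close> does so at every example.\<close>
  have tv: "\<bar>F S S - F S T\<bar> \<le> 2 * tv_dist (A S) (A T)" if "S \<in> space P" "T \<in> space P" for S T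
  proof -
    let ?tv = "tv_dist (A S) (A T)"
    have diff: "\<bar>error_prob (A S) z - error_prob (A T) z\<bar> \<le> ?tv" if z: "z \<in> space D" for z
    proof -
      have "space (A S) = space H" "space (A T) = space H"
        using AS(2)[OF \<open>S \<in> space P\<close>] AS(2)[OF \<open>T \<in> space P\<close>] by (auto dest: sets_eq_imp_space_eq)
      moreover have "{h \<in> space H. h (fst z) \<noteq> snd z} \<in> sets (A S)"
        using sets_mislabelling[OF H] z AS(2)[OF \<open>S \<in> space P\<close>] by (simp add: spD)
      ultimately show ?thesis
        unfolding error_prob_def
        using abs_measure_diff_le_tv_dist[OF AS(1)[OF \<open>S \<in> space P\<close>] AS(1)[OF \<open>T \<in> space P\<close>]] by simp
    qed
    have int: "integrable D (error_prob (A U))" if U: "U \<in> space P" for U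
      using measurable_compose[OF measurable_Pair1'[OF U] p] error_prob_bounds[OF AS(1)[OF U]]
      by (intro D.integrable_const_bound[where B = 1]) auto
    have "\<bar>(\<integral>z. error_prob (A S) z \<partial>D) - (\<integral>z. error_prob (A T) z \<partial>D)\<bar>
        = \<bar>\<integral>z. error_prob (A S) z - error_prob (A T) z \<partial>D\<bar>"
      using int that by simp
    also have "\<dots> \<le> (\<integral>z. \<bar>error_prob (A S) z - error_prob (A T) z\<bar> \<partial>D)"
      by (rule integral_abs_bound)
    also have "\<dots> \<le> (\<integral>z. ?tv \<partial>D)"
      by (rule integral_mono) (use int that diff in auto)
    finally have 1: "\<bar>(\<integral>z. error_prob (A S) z \<partial>D) - (\<integral>z. error_prob (A T) z \<partial>D)\<bar> \<le> ?tv"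
      by (simp add: D.prob_space)
    have "\<bar>(\<Sum>i<n. error_prob (A S) (S i)) - (\<Sum>i<n. error_prob (A T) (S i))\<bar>
        \<le> (\<Sum>i<n. \<bar>error_prob (A S) (S i) - error_prob (A T) (S i)\<bar>)"
      by (simp flip: sum_subtractf)
    also have "\<dots> \<le> (\<Sum>i<n. ?tv)"
      by (intro sum_mono diff Si that) simp
    finally have "\<bar>(\<Sum>i<n. error_prob (A S) (S i)) - (\<Sum>i<n. error_prob (A T) (S i))\<bar> / real n \<le> ?tv"
      using assms(5) by (simp add: field_simps)
    then have 2: "\<bar>(\<Sum>i<n. error_prob (A S) (S i)) / real n
        - (\<Sum>i<n. error_prob (A T) (S i)) / real n\<bar> \<le> ?tv"
      by (simp add: diff_divide_distrib[symmetric])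
    from 1 2 show ?thesis unfolding F_def by linarith
  qed

  let ?g = "\<lambda>w. ennreal (\<bar>F (fst w) (fst w) - F (fst w) (snd w)\<bar> / 2)"
  txt \<open>
    The bound on the lower integral of the total variation distance suffices, because only the
    measurable minorant \<open>?g\<close> of the distance is needed.
  \<close>
  have "(\<integral>\<^sup>+w. ?g w \<partial>?Q) \<le> (\<integral>\<^sup>+ (S, T). ennreal (tv_dist (A S) (A T)) \<partial>?Q)"
  proof (rule nn_integral_mono)
    fix w assume "w \<in> space ?Q"
    then have "fst w \<in> space P" "snd w \<in> space P" by (auto simp: space_pair_measure)
    from tv[OF this] show "?g w \<le> (case w of (S, T) \<Rightarrow> ennreal (tv_dist (A S) (A T)))"
      by (auto simp: case_prod_beta intro!: ennreal_leI)
  qed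
  also have "\<dots> \<le> ennreal \<rho>"
    using assms(6,8) by (simp add: tv_indistinguishable_def P_def)
  finally have g: "(\<integral>\<^sup>+w. ?g w \<partial>?Q) \<le> ennreal \<rho>" .
  \<comment> \<open>The event in the normalized form for Markov: \<open>?g\<close> is half the
    change, so the threshold \<open>sqrt \<rho>\<close> becomes
    \<open>sqrt \<rho> / 2\<close>.\<close>
  have "E2 = {w \<in> space ?Q. 1 \<le> ennreal (2 / sqrt \<rho>) * ?g w}"
    using assms(3) unfolding E2_def
    by (auto simp: ennreal_mult'[symmetric] field_simps)
  also have "emeasure ?Q \<dots> \<le> ennreal (2 / sqrt \<rho>) * (\<integral>\<^sup>+w. ?g w * indicator (space ?Q) w \<partial>?Q)"
    by (rule nn_integral_Markov_inequality) auto
  also have "(\<integral>\<^sup>+w. ?g w * indicator (space ?Q) w \<partial>?Q) = (\<integral>\<^sup>+w. ?g w \<partial>?Q)"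
    by (rule nn_integral_cong) simp
  also have "ennreal (2 / sqrt \<rho>) * (\<integral>\<^sup>+w. ?g w \<partial>?Q) \<le> ennreal (2 / sqrt \<rho>) * ennreal \<rho>"
    by (rule mult_left_mono[OF g]) simp
  also have "\<dots> = ennreal (2 * sqrt \<rho>)"
    using assms(3) by (simp add: ennreal_mult'[symmetric] real_div_sqrt flip: times_divide_eq_right)
  finally have E2: "measure ?Q E2 \<le> 2 * sqrt \<rho>"
    using assms(3) by (simp add: Q.P.emeasure_eq_measure)

  define Good where "Good = {S \<in> space P. \<bar>F S S\<bar> \<le> \<epsilon> + sqrt \<rho>}"
  have [measurable]: "Good \<in> sets P" unfolding Good_def by measurable
  \<comment> \<open>The event concerns \<open>S\<close> alone; adjoining the auxiliary sample
    \<open>T\<close> keeps its probability and makes it comparable with \<open>E1\<close> and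
    \<open>E2\<close>.\<close>
  have "measure P (space P - Good) = measure ?Q ((space P - Good) \<times> space P)"
    by (simp add: measure_def P.emeasure_pair_measure_Times P.emeasure_space_1)
  also have "\<dots> \<le> measure ?Q (E1 \<union> E2)"
  proof (rule Q.P.finite_measure_mono)
    \<comment> \<open>Outside both events the triangle inequality puts \<open>F S S\<close> strictly
      below \<open>\<epsilon> + sqrt \<rho>\<close> in absolute value.\<close>
    show "(space P - Good) \<times> space P \<subseteq> E1 \<union> E2"
      by (auto simp: Good_def E1_def E2_def space_pair_measure)
  qed measurable
  also have "\<dots> \<le> measure ?Q E1 + measure ?Q E2"
    by (rule measure_subadditive) (auto simp: Q.P.emeasure_eq_measure)
  \<comment> \<open>The two events contribute at most \<open>\<delta> + 2 * sqrt \<rho>\<close>,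
    which is within the stated bound.\<close>
  also have "\<dots> \<le> \<delta> + 4 * sqrt \<rho>"
    using E1 E2 assms(3) real_sqrt_ge_zero[of \<rho>] by linarith
  finally have "1 - \<delta> - 4 * sqrt \<rho> \<le> measure P Good"
    using P.prob_compl[of Good] by simp
  moreover have "Good = {S \<in> space P. \<bar>(\<integral>h. loss D h \<partial>A S) - (\<integral>h. empirical_loss n S h \<partial>A S)\<bar>
      \<le> sqrt (ln (2 / \<delta>) / (2 * real n)) + sqrt \<rho>}"
    unfolding Good_def by (auto simp: gap \<epsilon>_def)
  ultimately show ?thesis by (simp add: P_def)
qed

end
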